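(* Let $k$ be a nonzero integer and let $\mathbf{F}_q$ be a finite field with $q$ elements, of characteristic $p$. Set \[a=\frac{q-1}{\gcd(k,q-1)},\qquad b=\frac{q^2-1}{\gcd(k,q^2-1)},\qquad c=\frac{q^2+q+1}{\gcd(k,q^2+q+1)}.\] Let $\mathcal{T}_k:\mathbf{F}_q^2\to\mathbf{F}_q^2$ be the map induced by the bivariate Chebyshev map, and let $V(\mathcal{T}_k,\mathbf{F}_q^2)=\{\mathcal{T}_k(x,y):(x,y)\in\mathbf{F}_q^2\}$ be its value set. Then \[|V(\mathcal{T}_k,\mathbf{F}_q^2)|=\frac{a^2}{6}+\frac{b}{2}+\frac{c}{3}+\eta(k,q),\] where $\eta(k,q)$ is given as follows: - if ($2\nmid k$ or $2\nmid b$) and ($3\nmid k$ or $3\nmid a$), then $\eta(k,q)=0$; - if ($2\nmid k$ or $2\nmid b$) and ($3\mid k$ and $3\mid a$), then $\eta(k,q)=\frac{2}{3}$; - if ($2\mid k$ and $2\mid b$) and ($3\nmid k$ or $3\nmid a$), then $\eta(k,q)=\frac{a}{2}$; - if ($2\mid k$ and $2\mid b$) and ($3\mid k$ and $3\mid a$), then $\eta(k,q)=\frac{a}{2}+\frac{2}{3}$. In particular, if $\gcd(k,6)=1$, then $\eta(k,q)=0$.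
   Context: The generalized (bivariate) Chebyshev polynomials $g_k(x,y)\in\mathbf{Z}[x,y]$, $k\in\mathbf{Z}$, are defined by $g_{-1}(x,y)=y$, $g_0(x,y)=3$, $g_1(x,y)=x$ and the recurrence \[g_k(x,y)=x\,g_{k-1}(x,y)-y\,g_{k-2}(x,y)+g_{k-3}(x,y),\] used in both directions so that $g_k$ is defined for all $k\in\mathbf{Z}$. The bivariate Chebyshev map is $\mathcal{T}_k(x,y)=(g_k(x,y),g_k(y,x))$. Since $g_k$ has integer coefficients, reducing the coefficients modulo $p$ gives a map $\mathcal{T}_k:\mathbf{F}_q^2\to\mathbf{F}_q^2$ for any finite field $\mathbf{F}_q$ of characteristic $p$. *)

theory Defs
  imports Complex_Main "HOL-Computational_Algebra.Polynomial"
begin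

text \<open>
  The ring \<open>\<int>[x,y]\<close> is represented as \<open>\<int>[x][y]\<close>, i.e. by the type \<^typ>\<open>int poly poly\<close>:
  the inner variable is \<open>x\<close>, the outer one is \<open>y\<close>.
\<close>

definition var_x :: "int poly poly" where
  "var_x = [:[:0, 1:]:]"

definition var_y :: "int poly poly" where
  "var_y = [:0, 1:]"

function gen_cheb :: "int \<Rightarrow> int poly poly" where
  "gen_cheb k =
     (if k = -1 then var_y
      else if k = 0 then 3
      else if k = 1 then var_x
      else if k > 1 then
        var_x * gen_cheb (k - 1) - var_y * gen_cheb (k - 2) + gen_cheb (k - 3)
      else
        gen_cheb (k + 3) - var_x * gen_cheb (k + 2) + var_y * gen_cheb (k + 1))"
  by auto
termination
  by (relation "measure (\<lambda>k. nat \<bar>k\<bar>)") auto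

declare gen_cheb.simps [simp del]

lemma gen_cheb_initial:
  "gen_cheb (-1) = var_y" "gen_cheb 0 = 3" "gen_cheb 1 = var_x"
  by (simp_all add: gen_cheb.simps)

lemma gen_cheb_rec:
  "gen_cheb k = var_x * gen_cheb (k - 1) - var_y * gen_cheb (k - 2) + gen_cheb (k - 3)"
proof (cases "k > 1")
  case True
  then show ?thesis
    by (subst gen_cheb.simps) simp
next
  case False
  then have "gen_cheb (k - 3) = gen_cheb k - var_x * gen_cheb (k - 1) + var_y * gen_cheb (k - 2)"
    by (subst gen_cheb.simps) simp
  then show ?thesis
    by simp
qed

text \<open>
  In a field of characteristic \<open>p\<close>, \<^const>\<open>of_int\<close> factors through \<open>\<int>/p\<int>\<close>, so mapping it over
  the coefficients is their reduction modulo \<open>p\<close>.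
\<close>

definition eval2 :: "int poly poly \<Rightarrow> 'a::comm_ring_1 \<Rightarrow> 'a \<Rightarrow> 'a" where
  "eval2 P x y = poly (poly (map_poly (map_poly of_int) P) [:y:]) x"

definition cheb_map :: "int \<Rightarrow> 'a::comm_ring_1 \<times> 'a \<Rightarrow> 'a \<times> 'a" where
  "cheb_map k = (\<lambda>(x, y). (eval2 (gen_cheb k) x y, eval2 (gen_cheb k) y x))"

text \<open>The divisions below are exact.\<close>

definition cheb_a :: "int \<Rightarrow> nat \<Rightarrow> int" where
  "cheb_a k q = (int q - 1) div gcd k (int q - 1)"

definition cheb_b :: "int \<Rightarrow> nat \<Rightarrow> int" where
  "cheb_b k q = (int q ^ 2 - 1) div gcd k (int q ^ 2 - 1)"

definition cheb_c :: "int \<Rightarrow> nat \<Rightarrow> int" where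
  "cheb_c k q = (int q ^ 2 + int q + 1) div gcd k (int q ^ 2 + int q + 1)"

definition cheb_eta :: "int \<Rightarrow> nat \<Rightarrow> real" where
  "cheb_eta k q =
     (let a = cheb_a k q; b = cheb_b k q in
      if (\<not> 2 dvd k \<or> \<not> 2 dvd b) \<and> (\<not> 3 dvd k \<or> \<not> 3 dvd a) then 0
      else if (\<not> 2 dvd k \<or> \<not> 2 dvd b) \<and> (3 dvd k \<and> 3 dvd a) then 2 / 3
      else if (2 dvd k \<and> 2 dvd b) \<and> (\<not> 3 dvd k \<or> \<not> 3 dvd a) then of_int a / 2
      else of_int a / 2 + 2 / 3)"

end

theory Submission
  imports Defs "HOL-Algebra.Algebraic_Closure_Type"
begin

text \<open>
  Over an algebraically closed field every point \<open>(x, y)\<close> is given by the elementary symmetric functions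
  \<open>(u + v + w, uv + vw + wu)\<close> of a triple with \<open>uvw = 1\<close>, unique up to order: the roots of
  \<open>T\<^sup>3 - xT\<^sup>2 + yT - 1\<close>. The recurrence of the polynomials \<open>g\<^sub>k\<close> is the one for power sums of these roots,
  so in these coordinates the Chebyshev map raises \<open>u\<close>, \<open>v\<close>, \<open>w\<close> to the \<open>k\<close>-th power
  (\<open>cheb_map_esym\<close>).

  The points over the field of \<open>q\<close> elements are those whose triple is permuted by Frobenius. According
  to the permutation there are three families (\<open>rational_points\<close>): all entries are \<open>(q-1)\<close>-st roots of
  unity; or the entries are \<open>u\<close>, \<open>u\<^sup>q\<close> and \<open>u\<^bsup>-1-q\<^esup>\<close> with \<open>u\<close> a \<open>(q\<^sup>2-1)\<close>-st root of unity; or they are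
  the conjugates \<open>u\<close>, \<open>u\<^sup>q\<close>, \<open>(u\<^sup>q)\<^sup>q\<close> of a \<open>(q\<^sup>2+q+1)\<close>-st root of unity. The \<open>k\<close>-th power maps the \<open>n\<close>-th roots of
  unity onto the \<open>n/gcd(k,n)\<close>-th ones. Hence the value set consists of the same three families with the
  orders \<open>q-1\<close>, \<open>q\<^sup>2-1\<close>, \<open>q\<^sup>2+q+1\<close> replaced by \<open>a\<close>, \<open>b\<close>, \<open>c\<close>.

  On triples with distinct entries the parametrisations are 6-to-1, 2-to-1 and 3-to-1, which explains the
  main terms \<open>a\<^sup>2/6\<close>, \<open>b/2\<close>, \<open>c/3\<close>. The families meet only in points with a repeated entry
  \<open>u, u, u\<^bsup>-2\<^esup>\<close>. Counting these separately (\<open>card_value_set\<close>) leaves a correction that depends on how many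
  rational elements the \<open>b\<close>-th and the \<open>c\<close>-th roots of unity contain. There are \<open>a\<close> or \<open>2a\<close> of the former, and
  the second case gives the term \<open>a/2\<close> (\<open>gcd_quotient_rational\<close>); the latter are cube roots of unity, and
  give the term \<open>2/3\<close> (\<open>cube_roots_balance\<close>).
\<close>

section \<open>Cubics and their roots\<close>

definition esym :: "'k::field \<Rightarrow> 'k \<Rightarrow> 'k \<Rightarrow> 'k \<times> 'k" where
  "esym u v w = (u + v + w, u * v + v * w + w * u)"

lemma prod_linear_factors:
  fixes u v w :: "'k::field"
  shows "(\<Prod>x\<in>#{#u, v, w#}. [:- x, 1:]) =
    [:- (u * v * w), snd (esym u v w), - fst (esym u v w), 1:]"
  by (simp add: esym_def algebra_simps)

text \<open>
  Unique factorisation: the triple is recovered as the roots of the monic cubic whose coefficients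
  are its elementary symmetric functions, the constant coefficient being fixed by the product.
\<close>

lemma esym_eq_iff:
  fixes u v w u' v' w' :: "'k::field"
  assumes "u * v * w = u' * v' * w'"
  shows "esym u v w = esym u' v' w' \<longleftrightarrow> {#u, v, w#} = {#u', v', w'#}"
proof
  have roots: "proots (\<Prod>x\<in>#M. [:- x, 1:]) = M" for M :: "'k multiset"
  proof (induction M)
    case (add x M)
    have "(\<Prod>x\<in>#M. [:- x, 1:]) \<noteq> 0"
      by (auto simp: prod_mset_zero_iff)
    then have "proots ([:- x, 1:] * (\<Prod>x\<in>#M. [:- x, 1:])) = proots [:- x, 1:] + M"
      using add by (subst proots_mult) auto
    then show ?case by simp
  qed simp
  assume "esym u v w = esym u' v' w'"
  then have "(\<Prod>x\<in>#{#u, v, w#}. [:- x, 1:]) = (\<Prod>x\<in>#{#u', v', w'#}. [:- x, 1:])"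
    unfolding prod_linear_factors assms by simp
  then show "{#u, v, w#} = {#u', v', w'#}"
    using roots by metis
next
  assume "{#u, v, w#} = {#u', v', w'#}"
  then have "(\<Prod>x\<in>#{#u, v, w#}. [:- x, 1:]) = (\<Prod>x\<in>#{#u', v', w'#}. [:- x, 1:])"
    by simp
  then show "esym u v w = esym u' v' w'"
    unfolding prod_linear_factors by (simp add: prod_eq_iff)
qed

lemma triple_mset_eq_iff:
  "{#u, v, w#} = {#u', v', w'#} \<longleftrightarrow>
     u = u' \<and> (v = v' \<and> w = w' \<or> v = w' \<and> w = v') \<or>
     u = v' \<and> (v = u' \<and> w = w' \<or> v = w' \<and> w = u') \<or>
     u = w' \<and> (v = u' \<and> w = v' \<or> v = v' \<and> w = u')"
  by (auto simp: add_eq_conv_ex)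

lemma esym_surj:
  fixes x y :: "'k::alg_closed_field"
  obtains u v w where "u * v * w = 1" "esym u v w = (x, y)"
proof -
  let ?p = "[:- 1, y, - x, 1:]"
  have "?p \<noteq> 0" by simp
  from alg_closed_imp_factorization[OF this]
  obtain A where A: "size A = 3" "?p = (\<Prod>r\<in>#A. [:- r, 1:])"
    by (auto simp: numeral_3_eq_3)
  then obtain u v w where "A = {#u, v, w#}"
    by (metis numeral_3_eq_3 size_eq_Suc_imp_eq_union size_add_mset nat.inject size_eq_0_iff_empty)
  then have "?p = [:- (u * v * w), snd (esym u v w), - fst (esym u v w), 1:]"
    using A(2) prod_linear_factors by metis
  then show ?thesis
    by (intro that[of u v w]) (auto simp: prod_eq_iff)
qed

section \<open>Chebyshev polynomials as power sums\<close>

lemma map_poly_of_int_ring_hom: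
  shows "map_poly (of_int :: int \<Rightarrow> 'k::comm_ring_1) (p + q) = map_poly of_int p + map_poly of_int q"
    and "map_poly (of_int :: int \<Rightarrow> 'k) (p - q) = map_poly of_int p - map_poly of_int q"
    and "map_poly (of_int :: int \<Rightarrow> 'k) (p * q) = map_poly of_int p * map_poly of_int q"
  by (simp_all add: poly_eq_iff coeff_map_poly coeff_mult)

lemma eval2_ring_hom:
  fixes x y :: "'k::comm_ring_1"
  shows "eval2 (P + Q) x y = eval2 P x y + eval2 Q x y"
    and "eval2 (P - Q) x y = eval2 P x y - eval2 Q x y"
    and "eval2 (P * Q) x y = eval2 P x y * eval2 Q x y"
proof -
  let ?h = "map_poly (map_poly (of_int :: int \<Rightarrow> 'k))"
  have "?h (P + Q) = ?h P + ?h Q" "?h (P - Q) = ?h P - ?h Q" "?h (P * Q) = ?h P * ?h Q"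
    by (simp_all add: poly_eq_iff[of "?h _"] coeff_map_poly coeff_mult map_poly_of_int_ring_hom
        poly_eq_iff coeff_sum)
  then show "eval2 (P + Q) x y = eval2 P x y + eval2 Q x y"
    "eval2 (P - Q) x y = eval2 P x y - eval2 Q x y"
    "eval2 (P * Q) x y = eval2 P x y * eval2 Q x y"
    by (simp_all add: eval2_def)
qed

lemma eval2_gen_cheb_initial:
  fixes x y :: "'k::comm_ring_1"
  shows "eval2 (gen_cheb (-1)) x y = y" "eval2 (gen_cheb 0) x y = 3" "eval2 (gen_cheb 1) x y = x"
  by (simp_all add: gen_cheb_initial eval2_def var_x_def var_y_def map_poly_pCons numeral_poly)

lemma eval2_gen_cheb_rec:
  fixes x y :: "'k::comm_ring_1"
  shows "eval2 (gen_cheb k) x y = x * eval2 (gen_cheb (k - 1)) x y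
    - y * eval2 (gen_cheb (k - 2)) x y + eval2 (gen_cheb (k - 3)) x y"
  using eval2_gen_cheb_initial[of x y]
  by (subst gen_cheb_rec) (simp add: eval2_ring_hom gen_cheb_initial)

text \<open>
  The recurrence runs in both directions and determines a two-sided sequence from three consecutive
  terms, so evaluating the polynomials can be replaced by exhibiting any solution.
\<close>

lemma gen_cheb_unique:
  fixes s :: "int \<Rightarrow> 'k::comm_ring_1"
  assumes init: "s (-1) = y" "s 0 = 3" "s 1 = x"
    and rec: "\<And>k. s k = x * s (k - 1) - y * s (k - 2) + s (k - 3)"
  shows "eval2 (gen_cheb k) x y = s k"
proof (induction k rule: gen_cheb.induct)
  case (1 k)
  consider "k \<in> {-1, 0, 1}" | "k > 1" | "k < -1" by fastforce
  then show ?case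
  proof cases
    case 1
    then show ?thesis by (auto simp: eval2_gen_cheb_initial init)
  next
    case 2
    with 1 show ?thesis
      by (subst eval2_gen_cheb_rec, subst rec) simp
  next
    case 3
    with 1 show ?thesis
      using eval2_gen_cheb_rec[of "k + 3" x y] rec[of "k + 3"] by (simp add: algebra_simps)
  qed
qed

text \<open>
  By the recurrence, \<open>g\<^sub>k\<close> at \<open>(e\<^sub>1, e\<^sub>2)\<close> is the power sum \<open>u\<^sup>k + v\<^sup>k + w\<^sup>k\<close>, since each root
  satisfies \<open>r\<^sup>3 = e\<^sub>1 r\<^sup>2 - e\<^sub>2 r + 1\<close>. Exchanging the arguments replaces the roots by their
  inverses \<open>vw\<close>, \<open>wu\<close>, \<open>uv\<close>, and this turns the second coordinate into the second elementary
  symmetric function of the \<open>k\<close>-th powers.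
\<close>

lemma cheb_map_esym:
  fixes u v w :: "'k::field"
  assumes uvw: "u * v * w = 1"
  shows "cheb_map k (esym u v w) = esym (u powi k) (v powi k) (w powi k)"
proof -
  have power_sum: "eval2 (gen_cheb k) (u + v + w) (u * v + v * w + w * u)
      = u powi k + v powi k + w powi k"
    if uvw: "u * v * w = 1" for u v w :: 'k
  proof (rule gen_cheb_unique)
    have nz: "u \<noteq> 0" "v \<noteq> 0" "w \<noteq> 0" using uvw by auto
    have inv: "inverse u = v * w" "inverse v = w * u" "inverse w = u * v"
      using uvw by (auto intro!: inverse_unique simp: mult_ac)
    show "u powi -1 + v powi -1 + w powi -1 = u * v + v * w + w * u"
      by (simp add: power_int_minus inv)
    fix k :: int
    have root: "r powi k = (u + v + w) * r powi (k - 1) - (u * v + v * w + w * u) * r powi (k - 2)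
        + r powi (k - 3)" if "r \<in> {u, v, w}" for r
    proof -
      have "r \<noteq> 0" using that nz by auto
      then have "r powi k = r powi (k - 3) * r ^ 3" "r powi (k - 1) = r powi (k - 3) * r ^ 2"
        "r powi (k - 2) = r powi (k - 3) * r"
        using power_int_add[of r "k - 3" 3] power_int_add[of r "k - 3" 2]
          power_int_add[of r "k - 3" 1] by simp_all
      moreover have "r ^ 3 = (u + v + w) * r ^ 2 - (u * v + v * w + w * u) * r + u * v * w"
        using that by (auto simp: power2_eq_square power3_eq_cube algebra_simps)
      ultimately show ?thesis
        using uvw by (simp add: algebra_simps)
    qed
    show "u powi k + v powi k + w powi k =
      (u + v + w) * (u powi (k - 1) + v powi (k - 1) + w powi (k - 1)) -
      (u * v + v * w + w * u) * (u powi (k - 2) + v powi (k - 2) + w powi (k - 2)) +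
      (u powi (k - 3) + v powi (k - 3) + w powi (k - 3))"
      using root[of u] root[of v] root[of w] by (simp add: distrib_left distrib_right)
  qed auto
  have "(u * v) * (v * w) * (w * u) = (u * v * w) ^ 2"
    by (simp add: power2_eq_square mult_ac)
  then have prod_inv: "(u * v) * (v * w) * (w * u) = 1"
    using uvw by simp
  have "eval2 (gen_cheb k) (u * v + v * w + w * u) (u + v + w)
      = (u * v) powi k + (v * w) powi k + (w * u) powi k"
  proof -
    have "(u * v) * (v * w) + (v * w) * (w * u) + (w * u) * (u * v) = (u * v * w) * (u + v + w)"
      by (simp add: algebra_simps)
    then have "(u * v) * (v * w) + (v * w) * (w * u) + (w * u) * (u * v) = u + v + w"
      using uvw by simp
    then show ?thesis
      using power_sum[of "u * v" "v * w" "w * u"] prod_inv by simp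
  qed
  then show ?thesis
    by (simp add: cheb_map_def esym_def power_sum[OF uvw] power_int_mult_distrib)
qed

section \<open>Roots of unity\<close>

lemma card_eq_mult_card_image:
  assumes "finite S" and "\<And>s. s \<in> S \<Longrightarrow> card {t \<in> S. f t = f s} = m"
  shows "card S = m * card (f ` S)"
proof -
  have "card S = (\<Sum>y\<in>f ` S. card {t \<in> S. f t = y})"
    using sum.image_gen[OF assms(1), of "\<lambda>_. 1::nat" f] by simp
  also have "\<dots> = (\<Sum>y\<in>f ` S. m)"
    using assms(2) by (intro sum.cong) auto
  finally show ?thesis by simp
qed

definition unity_roots :: "nat \<Rightarrow> 'k::field set" where
  "unity_roots n = {z. z ^ n = 1}"

lemma unity_roots_nonzero: "z \<in> unity_roots n \<Longrightarrow> n > 0 \<Longrightarrow> z \<noteq> 0"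
  by (auto simp: unity_roots_def zero_power)

lemma unity_roots_dvd: "z \<in> unity_roots m \<Longrightarrow> m dvd n \<Longrightarrow> z \<in> unity_roots n"
  by (auto simp: unity_roots_def power_mult elim!: dvdE)

lemma unity_roots_mult: "z \<in> unity_roots n \<Longrightarrow> z' \<in> unity_roots n \<Longrightarrow> z * z' \<in> unity_roots n"
  by (simp add: unity_roots_def power_mult_distrib)

lemma unity_roots_inverse: "z \<in> unity_roots n \<Longrightarrow> inverse z \<in> unity_roots n"
  by (simp add: unity_roots_def power_inverse)

lemma unity_roots_power: "z \<in> unity_roots n \<Longrightarrow> z ^ m \<in> unity_roots n"
  by (metis (mono_tags, lifting) unity_roots_def mem_Collect_eq mult.commute power_mult power_one)

lemma unity_roots_Int:
  assumes "m > 0" "n > 0"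
  shows "unity_roots m \<inter> unity_roots n = (unity_roots (gcd m n) :: 'k::field set)"
proof
  show "unity_roots (gcd m n) \<subseteq> (unity_roots m \<inter> unity_roots n :: 'k set)"
    using unity_roots_dvd gcd_dvd1 gcd_dvd2 by blast
  show "unity_roots m \<inter> unity_roots n \<subseteq> (unity_roots (gcd m n) :: 'k set)"
  proof
    fix z :: 'k assume z: "z \<in> unity_roots m \<inter> unity_roots n"
    obtain x y where "m * x = n * y + gcd m n"
      using bezout_nat[of m n] assms by auto
    then have "(z ^ m) ^ x = (z ^ n) ^ y * z ^ gcd m n"
      by (metis power_add power_mult)
    then show "z \<in> unity_roots (gcd m n)"
      using z by (simp add: unity_roots_def)
  qed
qed

text \<open>
  The derivative \<open>n X\<^bsup>n-1\<^esup>\<close> of \<open>X\<^sup>n - 1\<close> vanishes at most at \<open>0\<close>, so the \<open>n\<close> roots are simple.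
\<close>

lemma card_unity_roots:
  assumes "of_nat n \<noteq> (0 :: 'k::alg_closed_field)"
  shows "card (unity_roots n :: 'k set) = n" "finite (unity_roots n :: 'k set)"
proof -
  let ?p = "Polynomial.monom 1 n - 1 :: 'k poly"
  have n: "n > 0" using assms by (cases n) auto
  have deg: "Polynomial.degree ?p = n" "Polynomial.coeff ?p n = 1"
    using n Polynomial.degree_add_eq_left[of "- 1" "Polynomial.monom (1::'k) n"]
    by (simp_all add: Polynomial.degree_monom_eq)
  then have "?p \<noteq> 0" using n by force
  from alg_closed_imp_factorization[OF this]
  obtain A where A: "size A = n" "?p = (\<Prod>r\<in>#A. [:- r, 1:])"
    by (metis deg smult_1_left)
  have roots: "set_mset A = unity_roots n"
  proof -
    have "z \<in># A \<longleftrightarrow> poly ?p z = 0" for z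
      unfolding A(2) by (auto simp: poly_prod_mset prod_mset_zero_iff)
    then show ?thesis
      by (auto simp: unity_roots_def poly_monom)
  qed
  have simple: "count A z = 1" if z: "z \<in># A" for z
  proof (rule ccontr)
    assume "count A z \<noteq> 1"
    moreover obtain B where B: "A = add_mset z B"
      using mset_add[OF z] by blast
    ultimately have "z \<in># B"
      by (auto simp: count_eq_zero_iff)
    then obtain C where "A = add_mset z (add_mset z C)"
      using B mset_add[of z B] by blast
    then have "?p = [:- z, 1:] * ([:- z, 1:] * (\<Prod>r\<in>#C. [:- r, 1:]))"
      using A(2) by simp
    then have "poly (pderiv ?p) z = 0"
      by (simp only: pderiv_mult poly_add poly_mult) simp
    then have "of_nat n * z ^ (n - 1) = 0"
      by (simp add: pderiv_diff pderiv_monom poly_monom)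
    then have "z = 0" using assms by auto
    then show False
      using z roots n by (auto simp: unity_roots_def zero_power)
  qed
  then have "card (unity_roots n :: 'k set) = size A"
    unfolding size_multiset_overloaded_eq roots[symmetric] by simp
  then show "card (unity_roots n :: 'k set) = n" "finite (unity_roots n :: 'k set)"
    using A(1) finite_set_mset[of A] unfolding roots by simp_all
qed

text \<open>
  The kernel of the \<open>k\<close>-th power on the \<open>n\<close>-th roots of unity consists of the \<open>gcd(k,n)\<close>-th roots of
  unity. Hence the image has \<open>n / gcd(k,n)\<close> elements, as many as the group of roots of unity of
  that order, which contains it.
\<close>

lemma image_power_int_unity_roots:
  assumes n: "of_nat n \<noteq> (0 :: 'k::alg_closed_field)" and k: "k \<noteq> 0"
  shows "(\<lambda>z. z powi k) ` (unity_roots n :: 'k set) = unity_roots (n div gcd (nat \<bar>k\<bar>) n)"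
proof -
  define d where "d = gcd (nat \<bar>k\<bar>) n"
  define m where "m = n div d"
  let ?U = "unity_roots n :: 'k set"
  have pos: "n > 0" "nat \<bar>k\<bar> > 0" using n k by (auto intro: Nat.gr0I)
  have n_eq: "n = d * m" "d dvd nat \<bar>k\<bar>"
    unfolding d_def m_def by (metis gcd_dvd2 dvd_mult_div_cancel, metis gcd_dvd1)
  then have of_nat_nz: "of_nat d \<noteq> (0 :: 'k)" "of_nat m \<noteq> (0 :: 'k)"
    using n by auto
  have abs_powi: "z powi k = 1 \<longleftrightarrow> z ^ nat \<bar>k\<bar> = 1" for z :: 'k
    by (auto simp: power_int_def power_inverse abs_if)
  have sub: "(\<lambda>z. z powi k) ` ?U \<subseteq> unity_roots m"
  proof clarify
    fix z assume z: "z \<in> ?U"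
    obtain j where j: "k = int d * j"
      using n_eq(2) by (metis dvdE int_dvd_int_iff int_nat_eq abs_ge_zero dvd_abs_iff)
    have "(z powi k) ^ m = (z ^ n) powi j"
      unfolding n_eq(1) by (simp add: power_int_power power_int_power' j mult_ac)
    then show "z powi k \<in> unity_roots m"
      using z by (simp add: unity_roots_def)
  qed
  have "card ?U = d * card ((\<lambda>z. z powi k) ` ?U)"
  proof (rule card_eq_mult_card_image)
    fix s assume s: "s \<in> ?U"
    then have s0: "s \<noteq> 0" using unity_roots_nonzero pos by blast
    have "{t \<in> ?U. t powi k = s powi k} = (\<lambda>z. s * z) ` (unity_roots (nat \<bar>k\<bar>) \<inter> ?U)"
    proof (intro equalityI subsetI)
      fix t assume t: "t \<in> {t \<in> ?U. t powi k = s powi k}"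
      then have "(t / s) powi k = 1"
        using s0 by (simp add: power_int_divide_distrib)
      then have "t / s \<in> unity_roots (nat \<bar>k\<bar>) \<inter> ?U"
        using t s unity_roots_mult[OF _ unity_roots_inverse[of s]]
        by (auto simp: abs_powi divide_inverse) (simp add: unity_roots_def abs_powi)
      moreover have "t = s * (t / s)" using s0 by simp
      ultimately show "t \<in> (\<lambda>z. s * z) ` (unity_roots (nat \<bar>k\<bar>) \<inter> ?U)" by blast
    next
      fix t assume "t \<in> (\<lambda>z. s * z) ` (unity_roots (nat \<bar>k\<bar>) \<inter> ?U)"
      then obtain z where z: "t = s * z" "z \<in> unity_roots (nat \<bar>k\<bar>)" "z \<in> ?U" by blast
      then have "z powi k = 1" by (simp add: abs_powi unity_roots_def)
      then show "t \<in> {t \<in> ?U. t powi k = s powi k}"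
        using z s unity_roots_mult by (auto simp: power_int_mult_distrib)
    qed
    also have "unity_roots (nat \<bar>k\<bar>) \<inter> ?U = unity_roots d"
      unfolding d_def using unity_roots_Int pos by blast
    also have "card ((\<lambda>z. s * z) ` unity_roots d) = d"
      using s0 card_unity_roots[OF of_nat_nz(1)] by (subst card_image) (auto simp: inj_on_def)
    finally show "card {t \<in> ?U. t powi k = s powi k} = d" .
  qed (rule card_unity_roots[OF n])
  then have "d * card ((\<lambda>z. z powi k) ` ?U) = d * m"
    using card_unity_roots(1)[OF n] n_eq(1) by simp
  then have "card ((\<lambda>z. z powi k) ` ?U) = card (unity_roots m :: 'k set)"
    using card_unity_roots(1)[OF of_nat_nz(2)] of_nat_nz(1) by (metis mult_left_cancel of_nat_0)
  then show ?thesis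
    using sub card_unity_roots(2)[OF of_nat_nz(2)] card_subset_eq
    unfolding m_def d_def by blast
qed

section \<open>The Frobenius map\<close>

lemma finite_field_power_card:
  fixes x :: "'a::{field, finite}"
  shows "x ^ card (UNIV :: 'a set) = x"
proof (cases "x = 0")
  case False
  let ?U = "UNIV - {0 :: 'a}"
  have "(\<Prod>y\<in>?U. y) = (\<Prod>y\<in>?U. x * y)"
    by (rule prod.reindex_bij_witness[of _ "\<lambda>y. x * y" "\<lambda>y. y / x"]) (use False in auto)
  also have "\<dots> = x ^ card ?U * (\<Prod>y\<in>?U. y)"
    by (simp add: prod.distrib)
  finally have "x ^ card ?U = 1"
    by simp
  moreover have "card (UNIV :: 'a set) = Suc (card ?U)"
    using card_Suc_Diff1[of "UNIV :: 'a set" 0] by simp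
  ultimately show ?thesis
    by (metis power_Suc mult.right_neutral)
qed (use finite_UNIV_card_ge_0[where ?'a = 'a] in auto)

text \<open>
  The polynomial \<open>(X + 1)\<^sup>q - X\<^sup>q - 1\<close> has degree less than \<open>q\<close> and vanishes at all \<open>q\<close> elements of the
  field, so it is zero. Its coefficients are the binomial coefficients that obstruct the additivity
  of the \<open>q\<close>-th power.
\<close>

lemma of_nat_card_choose:
  assumes i: "0 < i" "i < card (UNIV :: 'a::{field, finite} set)"
  shows "of_nat (card (UNIV :: 'a set) choose i) = (0 :: 'a)"
proof -
  define q where "q = card (UNIV :: 'a set)"
  define P where "P = (\<Sum>j\<in>{0<..<q}. Polynomial.monom (of_nat (q choose j) :: 'a) j)"
  have q: "q > 0" using i q_def by simp
  have vanish: "poly P x = 0" for x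
  proof -
    have "{..q} = insert 0 (insert q {0<..<q})" using q by auto
    then have "(x + 1) ^ q = 1 + x ^ q + poly P x"
      using q by (subst binomial_ring) (simp add: P_def poly_sum poly_monom)
    then show ?thesis
      unfolding q_def finite_field_power_card by simp
  qed
  have coeffs: "Polynomial.coeff P j = (if j \<in> {0<..<q} then of_nat (q choose j) else 0)" for j
    by (simp add: P_def coeff_sum)
  have "P = 0"
  proof (rule ccontr)
    assume P: "P \<noteq> 0"
    have "Polynomial.degree P \<le> q - 1"
      by (rule Polynomial.degree_le) (auto simp: coeffs)
    moreover have "q \<le> Polynomial.degree P"
      using card_poly_roots_bound[OF P] vanish by (simp add: q_def)
    ultimately show False using q by simp
  qed
  then show ?thesis
    using coeffs[of i] i by (simp add: q_def)
qed

text \<open>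
  An algebraically closed field on which the \<open>q\<close>-th power is a Frobenius map. The fixed points of
  this map form the subfield with \<open>q\<close> elements, whose elements are called rational below.
\<close>

locale frobenius =
  fixes field_type :: "'k::alg_closed_field itself" and q :: nat
  assumes q_gt_1: "q > 1"
    and of_nat_q: "of_nat q = (0 :: 'k)"
    and power_q_add: "(x + y :: 'k) ^ q = x ^ q + y ^ q"

lemma frobenius_alg_closure:
  "frobenius TYPE('a alg_closure) (card (UNIV :: 'a::{field, finite} set))"
proof
  define q where "q = card (UNIV :: 'a set)"
  have "card {0, 1 :: 'a} \<le> q"
    unfolding q_def by (intro card_mono) auto
  then show q_gt_1: "card (UNIV :: 'a set) > 1" by (simp add: q_def)
  have binom: "of_nat (q choose i) = (0 :: 'a alg_closure)" if "0 < i" "i < q" for i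
    using of_nat_card_choose[where 'a = 'a] that unfolding q_def by (metis to_ac_0 to_ac_of_nat)
  show "of_nat (card (UNIV :: 'a set)) = (0 :: 'a alg_closure)"
    using binom[of 1] q_gt_1 by (simp add: q_def)
  fix x y :: "'a alg_closure"
  have "{..q} = insert 0 (insert q {0<..<q})" using q_gt_1 q_def by auto
  then have "(x + y) ^ q = x ^ q + y ^ q"
    using q_gt_1 binom by (subst binomial_ring) (simp add: q_def add.commute)
  then show "(x + y) ^ card (UNIV :: 'a set) = x ^ card (UNIV :: 'a set) + y ^ card (UNIV :: 'a set)"
    by (simp add: q_def)
qed

text \<open>
  All elements of the finite field are roots of \<open>X\<^sup>q - X\<close>, and there is no room for further roots.
\<close>

lemma range_to_ac:
  "range (to_ac :: 'a::{field, finite} \<Rightarrow> _) = {z. z ^ card (UNIV :: 'a set) = z}"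
proof -
  define q where "q = card (UNIV :: 'a set)"
  let ?p = "Polynomial.monom 1 q - Polynomial.monom 1 1 :: 'a alg_closure poly"
  interpret frobenius "TYPE('a alg_closure)" q
    unfolding q_def by (rule frobenius_alg_closure)
  have "Polynomial.coeff ?p q = 1" using q_gt_1 by simp
  then have p: "?p \<noteq> 0" by (metis coeff_0 zero_neq_one)
  have roots: "{z. poly ?p z = 0} = {z. z ^ q = z}" by (simp add: poly_monom)
  have "Polynomial.degree ?p \<le> q"
    using q_gt_1 by (intro Polynomial.degree_le) auto
  moreover have "card {z :: 'a alg_closure. z ^ q = z} \<le> Polynomial.degree ?p"
    using card_poly_roots_bound[OF p] unfolding roots .
  moreover have "card (range (to_ac :: 'a \<Rightarrow> _)) = q"
    unfolding q_def by (rule card_image[OF inj_to_ac])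
  ultimately have "card {z :: 'a alg_closure. z ^ q = z} \<le> card (range (to_ac :: 'a \<Rightarrow> _))"
    by linarith
  moreover have "to_ac x ^ q = to_ac x" for x :: 'a
    by (simp only: q_def finite_field_power_card flip: to_ac_power)
  then have "range (to_ac :: 'a \<Rightarrow> _) \<subseteq> {z. z ^ q = z}"
    by blast
  moreover have "finite {z :: 'a alg_closure. z ^ q = z}"
    using poly_roots_finite[OF p] roots by simp
  ultimately show ?thesis
    unfolding q_def by (meson card_seteq)
qed

lemma to_ac_eval2_gen_cheb:
  fixes x y :: "'a::field"
  shows "to_ac (eval2 (gen_cheb k) x y) = eval2 (gen_cheb k) (to_ac x) (to_ac y)"
proof (rule gen_cheb_unique[symmetric])
  fix k
  show "to_ac (eval2 (gen_cheb k) x y) = to_ac x * to_ac (eval2 (gen_cheb (k - 1)) x y) -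
      to_ac y * to_ac (eval2 (gen_cheb (k - 2)) x y) + to_ac (eval2 (gen_cheb (k - 3)) x y)"
    by (subst eval2_gen_cheb_rec) simp
qed (simp_all add: eval2_gen_cheb_initial)

section \<open>Points fixed by Frobenius\<close>

text \<open>
  The conjugate triples that belong to quadratic and to cubic extensions both have the form \<open>point u (u ^ q)\<close>, with
  third entry \<open>u\<^bsup>-1-q\<^esup>\<close>; in the cubic case this is \<open>(u\<^sup>q)\<^sup>q\<close>.
\<close>

definition point :: "'k::field \<Rightarrow> 'k \<Rightarrow> 'k \<times> 'k" where
  "point u v = esym u v (inverse (u * v))"

lemma point_prod:
  "u \<noteq> 0 \<Longrightarrow> v \<noteq> 0 \<Longrightarrow> u * v * inverse (u * v) = (1 :: 'k::field)"
  by (simp del: inverse_mult_distrib)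

lemma point_eq_iff:
  assumes "u \<noteq> 0" "v \<noteq> 0" "u' \<noteq> 0" "v' \<noteq> 0"
  shows "point u v = point u' v' \<longleftrightarrow>
    {#u, v, inverse (u * v)#} = {#u', v', inverse (u' * v')#}"
  unfolding point_def using assms by (intro esym_eq_iff) (simp del: inverse_mult_distrib)

lemma esym_eq_point:
  assumes "u * v * w = 1"
  shows "esym u v w = point u v" "esym u v w = point u w" "esym u v w = point v u"
    "esym u v w = point v w" "esym u v w = point w u" "esym u v w = point w v"
proof -
  have aux: "esym u v w = point u v" if "u * v * w = 1" for u v w :: 'a
  proof -
    have "inverse (u * v) = w" using that by (rule inverse_unique)
    then show ?thesis by (simp add: point_def)
  qed
  show "esym u v w = point u v" "esym u v w = point u w" "esym u v w = point v u"
    "esym u v w = point v w" "esym u v w = point w u" "esym u v w = point w v"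
    using aux[of u v w] aux[of u w v] aux[of v u w] aux[of v w u] aux[of w u v] aux[of w v u] assms
    by (simp_all add: esym_def mult_ac add_ac)
qed

lemma cheb_map_point:
  assumes "u \<noteq> 0" "v \<noteq> 0"
  shows "cheb_map k (point u v) = point (u powi k) (v powi k)"
  using cheb_map_esym[OF point_prod[OF assms], of k]
  by (simp add: point_def power_int_inverse power_int_mult_distrib)

context frobenius
begin

lemma power_q_eq_iff [simp]: "(x :: 'k) ^ q = y ^ q \<longleftrightarrow> x = y"
proof
  assume "x ^ q = y ^ q"
  moreover have "x ^ q = (x - y) ^ q + y ^ q"
    using power_q_add[of "x - y" y] by simp
  ultimately show "x = y" by simp
qed simp

lemma of_nat_neq_0: "coprime n q \<Longrightarrow> of_nat n \<noteq> (0 :: 'k)"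
proof
  assume "coprime n q" and n: "of_nat n = (0 :: 'k)"
  show False
  proof (cases "n = 0")
    case True
    then show False using \<open>coprime n q\<close> q_gt_1 by simp
  next
    case False
    then obtain x y where "n * x = q * y + gcd n q"
      using bezout_nat by blast
    then have "of_nat (n * x) = (of_nat (q * y + 1) :: 'k)"
      using \<open>coprime n q\<close> by (simp add: coprime_iff_gcd_eq_1)
    then show False using n of_nat_q by simp
  qed
qed

lemma square_minus_1_pos: "q ^ 2 - 1 > 0"
  using one_less_power[OF q_gt_1, of 2] by simp

lemma coprime_q:
  "coprime (q - 1) q" "coprime (q ^ 2 - 1) q" "coprime (q ^ 2 + q + 1) q"
proof -
  show "coprime (q - 1) q" using q_gt_1 by (cases q) simp_all
  have "coprime (q ^ 2 - 1) (q ^ 2)"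
    using q_gt_1 by (cases "q ^ 2") simp_all
  then show "coprime (q ^ 2 - 1) q" by simp
  have "coprime (q * (q + 1) + 1) q" by (metis coprime_mult_left_iff coprime_add_one_left coprime_commute)
  then show "coprime (q ^ 2 + q + 1) q" by (simp add: power2_eq_square algebra_simps)
qed

definition rational_units :: "'k set" where
  "rational_units = unity_roots (q - 1)"

lemma rational_units_iff: "z \<in> rational_units \<longleftrightarrow> z \<noteq> 0 \<and> z ^ q = z"
proof -
  have "z ^ q = z * z ^ (q - 1)"
    using q_gt_1 by (metis power_eq_if not_less0)
  then show ?thesis
    using q_gt_1 unfolding rational_units_def
    by (cases "z = 0") (auto simp: unity_roots_def zero_power)
qed

lemma frobenius_rational_units: "z ^ q \<in> rational_units \<longleftrightarrow> z \<in> rational_units"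
  using q_gt_1 by (auto simp: rational_units_iff)

lemma frobenius_esym:
  "esym (u ^ q) (v ^ q) (w ^ q) = (fst (esym u v w) ^ q, snd (esym u v w :: 'k \<times> 'k) ^ q)"
  by (simp add: esym_def power_q_add power_mult_distrib)

lemma esym_rational_iff:
  assumes "u * v * w = (1 :: 'k)"
  shows "fst (esym u v w) ^ q = fst (esym u v w) \<and> snd (esym u v w) ^ q = snd (esym u v w)
    \<longleftrightarrow> {#u ^ q, v ^ q, w ^ q#} = {#u, v, w#}"
proof -
  have "u ^ q * v ^ q * w ^ q = u * v * w"
    using assms by (simp flip: power_mult_distrib)
  from esym_eq_iff[OF this] show ?thesis
    unfolding frobenius_esym by (auto simp: prod_eq_iff)
qed

lemma quadratic_root_of_unity:
  assumes "u \<noteq> (0 :: 'k)"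
  shows "u \<in> unity_roots (q ^ 2 - 1) \<longleftrightarrow> (u ^ q) ^ q = u"
proof -
  have "(u ^ q) ^ q = u * u ^ (q ^ 2 - 1)"
    using q_gt_1 by (metis power_eq_if power_mult power2_eq_square not_less0 power_not_zero)
  then show ?thesis using assms by (simp add: unity_roots_def)
qed

lemma cubic_root_of_unity: "u \<in> unity_roots (q ^ 2 + q + 1) \<longleftrightarrow> u * u ^ q * (u ^ q) ^ q = (1 :: 'k)"
proof -
  have "u ^ (q ^ 2 + q + 1) = u * u ^ q * (u ^ q) ^ q"
    by (simp only: power_add power2_eq_square power_mult power_one_right mult_ac)
  then show ?thesis by (simp only: unity_roots_def mem_Collect_eq)
qed

lemma cubic_frobenius:
  assumes "u \<in> unity_roots (q ^ 2 + q + 1)"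
  shows "((u ^ q) ^ q) ^ q = (u :: 'k)" "inverse (u * u ^ q) = (u ^ q) ^ q" "u \<noteq> 0"
proof -
  have n: "u * u ^ q * (u ^ q) ^ q = 1" using assms cubic_root_of_unity by blast
  then show "inverse (u * u ^ q) = (u ^ q) ^ q" by (rule inverse_unique)
  show u: "u \<noteq> 0" using n by auto
  have "u ^ q * (u ^ q) ^ q * ((u ^ q) ^ q) ^ q = 1"
    using arg_cong[OF n, of "\<lambda>x. x ^ q"] by (simp add: power_mult_distrib)
  with n have "u ^ q * (u ^ q) ^ q * ((u ^ q) ^ q) ^ q = u ^ q * (u ^ q) ^ q * u"
    by (simp add: mult_ac)
  then show "((u ^ q) ^ q) ^ q = u" using u by simp
qed

text \<open>
  Frobenius permutes the roots of a cubic with rational coefficients. If it fixes all of them, they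
  lie in the subfield of \<open>q\<close> elements; a transposition exchanges two conjugates \<open>u\<close>, \<open>u\<^sup>q\<close> with
  \<open>(u\<^sup>q)\<^sup>q = u\<close>; a three-cycle gives the orbit of some \<open>u\<close>, and then the product condition reads
  \<open>u ^ (q ^ 2 + q + 1) = 1\<close>.
\<close>

lemma rational_points:
  "{P :: 'k \<times> 'k. fst P ^ q = fst P \<and> snd P ^ q = snd P} =
    case_prod point ` (unity_roots (q - 1) \<times> unity_roots (q - 1)) \<union>
    (\<lambda>u. point u (u ^ q)) ` (unity_roots (q ^ 2 - 1) \<union> unity_roots (q ^ 2 + q + 1))"
  (is "?L = ?A \<union> ?B")
proof (intro equalityI subsetI)
  fix P :: "'k \<times> 'k" assume P: "P \<in> ?L"
  obtain u v w where uvw: "u * v * w = 1" and P_eq: "P = esym u v w"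
    using esym_surj by (metis prod.exhaust)
  have nz: "u \<noteq> 0" "v \<noteq> 0" "w \<noteq> 0" using uvw by auto
  note pts = esym_eq_point[OF uvw]
  have "{#u ^ q, v ^ q, w ^ q#} = {#u, v, w#}"
    using P esym_rational_iff[OF uvw] unfolding P_eq by simp
  then consider "u ^ q = u" "v ^ q = v"
    | "v ^ q = w" "w ^ q = v" | "u ^ q = v" "v ^ q = u" | "u ^ q = w" "w ^ q = u"
    | "u ^ q = v" "v ^ q = w" | "u ^ q = w" "w ^ q = v"
    unfolding triple_mset_eq_iff by blast
  then show "P \<in> ?A \<union> ?B"
  proof cases
    case 1
    then have "(u, v) \<in> unity_roots (q - 1) \<times> unity_roots (q - 1)"
      using nz rational_units_iff unfolding rational_units_def by auto
    then show ?thesis unfolding P_eq pts(1) by force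
  next
    case 2
    then show ?thesis using nz(2) quadratic_root_of_unity[of v] unfolding P_eq pts(4) by blast
  next
    case 3
    then show ?thesis using nz(1) quadratic_root_of_unity[of u] unfolding P_eq pts(1) by blast
  next
    case 4
    then show ?thesis using nz(1) quadratic_root_of_unity[of u] unfolding P_eq pts(2) by blast
  next
    case 5
    then show ?thesis using uvw cubic_root_of_unity[of u] unfolding P_eq pts(1) by blast
  next
    case 6
    then have "u \<in> unity_roots (q ^ 2 + q + 1)"
      using uvw cubic_root_of_unity[of u] by (simp add: mult_ac)
    then show ?thesis using 6 unfolding P_eq pts(2) by blast
  qed
next
  have mem: "point u v \<in> ?L"
    if "u \<noteq> 0" "v \<noteq> 0" "{#u ^ q, v ^ q, inverse (u * v) ^ q#} = {#u, v, inverse (u * v)#}" for u v :: 'k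
    using that esym_rational_iff[OF point_prod[of u v]] unfolding point_def by blast
  fix P :: "'k \<times> 'k" assume "P \<in> ?A \<union> ?B"
  then show "P \<in> ?L"
  proof (elim UnE)
    assume "P \<in> ?A"
    then obtain u v where uv: "P = point u v" "u \<in> rational_units" "v \<in> rational_units"
      unfolding rational_units_def by auto
    show ?thesis
      unfolding uv(1) using uv(2,3)
      by (intro mem) (simp_all add: rational_units_iff power_inverse power_mult_distrib)
  next
    assume "P \<in> ?B"
    then obtain u where u: "P = point u (u ^ q)"
      "u \<in> unity_roots (q ^ 2 - 1) \<or> u \<in> unity_roots (q ^ 2 + q + 1)" by blast
    show ?thesis
    proof (cases "u \<in> unity_roots (q ^ 2 + q + 1)")
      case True
      show ?thesis
        unfolding u(1) using cubic_frobenius[OF True]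
        by (intro mem) (auto simp: triple_mset_eq_iff)
    next
      case False
      have "u \<noteq> 0" using False u(2) unity_roots_nonzero square_minus_1_pos by blast
      then show ?thesis
        unfolding u(1) using False u(2) quadratic_root_of_unity[of u]
        by (intro mem) (auto simp: triple_mset_eq_iff power_inverse power_mult_distrib mult_ac)
    qed
  qed
qed

lemma image_cheb_map_rational_points:
  assumes k: "k \<noteq> 0"
  defines "K \<equiv> nat \<bar>k\<bar>"
  defines "a \<equiv> (q - 1) div gcd K (q - 1)" and "b \<equiv> (q ^ 2 - 1) div gcd K (q ^ 2 - 1)"
    and "c \<equiv> (q ^ 2 + q + 1) div gcd K (q ^ 2 + q + 1)"
  shows "cheb_map k ` {P :: 'k \<times> 'k. fst P ^ q = fst P \<and> snd P ^ q = snd P} =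
    case_prod point ` (unity_roots a \<times> unity_roots a) \<union>
    (\<lambda>u. point u (u ^ q)) ` (unity_roots b \<union> unity_roots c)"
proof -
  let ?p = "\<lambda>z :: 'k. z powi k"
  have img: "?p ` unity_roots (q - 1) = unity_roots a"
    "?p ` unity_roots (q ^ 2 - 1) = unity_roots b"
    "?p ` unity_roots (q ^ 2 + q + 1) = unity_roots c"
    unfolding a_def b_def c_def K_def
    by (intro image_power_int_unity_roots of_nat_neq_0 coprime_q k)+
  have nz: "u \<noteq> 0" if "u \<in> unity_roots (q - 1) \<union> unity_roots (q ^ 2 - 1) \<union> unity_roots (q ^ 2 + q + 1)" for u :: 'k
    using that q_gt_1 unity_roots_nonzero square_minus_1_pos by (metis UnE zero_less_diff add_gr_0 zero_less_one)
  have "cheb_map k ` case_prod point ` (unity_roots (q - 1) \<times> unity_roots (q - 1)) =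
      case_prod point ` map_prod ?p ?p ` (unity_roots (q - 1) \<times> unity_roots (q - 1))"
    unfolding image_image using nz
    by (intro image_cong) (auto simp: cheb_map_point)
  also have "\<dots> = case_prod point ` (unity_roots a \<times> unity_roots a)"
    by (subst map_prod_surj_on[OF img(1) img(1)]) simp
  finally have A: "cheb_map k ` case_prod point ` (unity_roots (q - 1) \<times> unity_roots (q - 1)) =
    case_prod point ` (unity_roots a \<times> unity_roots a :: ('k \<times> 'k) set)" .
  have "cheb_map k ` (\<lambda>u. point u (u ^ q)) ` (unity_roots (q ^ 2 - 1) \<union> unity_roots (q ^ 2 + q + 1)) =
      (\<lambda>u. point u (u ^ q)) ` ?p ` (unity_roots (q ^ 2 - 1) \<union> unity_roots (q ^ 2 + q + 1))"
    unfolding image_image using nz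
    by (intro image_cong) (auto simp: cheb_map_point power_int_power power_int_power' mult.commute)
  also have "\<dots> = (\<lambda>u. point u (u ^ q)) ` (unity_roots b \<union> unity_roots c)"
    unfolding image_Un img ..
  finally show ?thesis
    unfolding rational_points image_Un A by simp
qed

end

section \<open>Counting the values\<close>

lemma cube_root_of_unity_iff:
  assumes "u \<noteq> (0 :: 'k::field)"
  shows "inverse (u * u) = u \<longleftrightarrow> u \<in> unity_roots 3"
proof -
  have "inverse (u * u) = u \<longleftrightarrow> u * u * u = 1"
    using assms by (metis inverse_unique right_inverse mult_eq_0_iff)
  then show ?thesis by (simp add: unity_roots_def power3_eq_cube)
qed

context frobenius
begin

lemma finite_unity_roots_dvd:
  assumes "n dvd m" "coprime m q"
  shows "finite (unity_roots n :: 'k set)" "card (unity_roots n :: 'k set) = n" "n > 0"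
proof -
  have "coprime n q" using assms by (metis coprime_divisors dvd_refl)
  then have n: "of_nat n \<noteq> (0 :: 'k)" by (rule of_nat_neq_0)
  then show "finite (unity_roots n :: 'k set)" "card (unity_roots n :: 'k set) = n"
    using card_unity_roots by blast+
  show "n > 0" using n by (auto intro: Nat.gr0I)
qed

lemma card_irrational_unity_roots:
  assumes "n dvd m" "coprime m q"
  shows "card (unity_roots n - rational_units :: 'k set) + gcd n (q - 1) = n"
proof -
  note U = finite_unity_roots_dvd[OF assms]
  have "unity_roots n \<inter> rational_units = (unity_roots (gcd n (q - 1)) :: 'k set)"
    unfolding rational_units_def using U(3) q_gt_1 by (intro unity_roots_Int) auto
  then have "card (unity_roots n \<inter> rational_units) = gcd n (q - 1)"
    using finite_unity_roots_dvd(2)[OF gcd_dvd2 coprime_q(1)] by simp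
  moreover have "card (unity_roots n - rational_units :: 'k set) + card (unity_roots n \<inter> rational_units)
      = card (unity_roots n :: 'k set)"
    using card_Int_Diff[OF U(1), of rational_units] by simp
  ultimately show ?thesis using U(2) by simp
qed

text \<open>
  A triple of distinct elements arises from the six ordered pairs of its entries. Among the \<open>a\<^sup>2\<close>
  pairs, three families of \<open>a\<close> pairs each produce a repeated entry, and any two of them have in common
  exactly the pairs \<open>(u, u)\<close> with \<open>u\<^sup>3 = 1\<close>.
\<close>

lemma card_split_points:
  assumes a: "a dvd q - 1"
  defines "A \<equiv> unity_roots a :: 'k set"
  defines "T \<equiv> {(u, v). u \<in> A \<and> v \<in> A \<and> u \<noteq> v \<and> u \<noteq> inverse (u * v) \<and> v \<noteq> inverse (u * v)}"
  shows "6 * card (case_prod point ` T) + 3 * a = a ^ 2 + 2 * gcd a 3"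
proof -
  have A: "finite A" "card A = a" "a > 0"
    unfolding A_def using finite_unity_roots_dvd[OF a coprime_q(1)] by blast+
  have nz: "u \<noteq> 0" if "u \<in> A" for u
    using that A(3) unity_roots_nonzero unfolding A_def by blast
  have inv: "inverse (u * v) \<in> A" if "u \<in> A" "v \<in> A" for u v
    using that unity_roots_mult unity_roots_inverse unfolding A_def by blast
  have finT: "finite T"
    by (rule finite_subset[of _ "A \<times> A"]) (auto simp: T_def A)
  have "card T = 6 * card (case_prod point ` T)"
  proof (rule card_eq_mult_card_image[OF finT])
    fix s assume s: "s \<in> T"
    then obtain u v where uv: "s = (u, v)" "u \<in> A" "v \<in> A"
      "u \<noteq> v" "u \<noteq> inverse (u * v)" "v \<noteq> inverse (u * v)"
      unfolding T_def by auto
    define w where "w = inverse (u * v)"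
    have w: "w \<in> A" "u \<noteq> w" "v \<noteq> w" using uv inv w_def by auto
    have prod: "u * v * w = 1" using point_prod nz uv unfolding w_def by blast
    have thirds: "inverse (u * v) = w" "inverse (v * u) = w" "inverse (u * w) = v"
      "inverse (w * u) = v" "inverse (v * w) = u" "inverse (w * v) = u"
      using prod by (intro inverse_unique, simp only: mult_ac)+
    \<comment> \<open>The fibre: the first two entries of the rearrangements of the triple.\<close>
    have "{t \<in> T. case_prod point t = case_prod point s} =
        {(u, v), (u, w), (v, u), (v, w), (w, u), (w, v)}"
    proof (intro equalityI subsetI)
      fix t assume t: "t \<in> {t \<in> T. case_prod point t = case_prod point s}"
      then obtain u' v' where t_eq: "t = (u', v')" "u' \<in> A" "v' \<in> A" "point u' v' = point u v"
        unfolding T_def uv(1) by auto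
      then have "{#u', v', inverse (u' * v')#} = {#u, v, w#}"
        using point_eq_iff nz uv w_def by blast
      then show "t \<in> {(u, v), (u, w), (v, u), (v, w), (w, u), (w, v)}"
        unfolding t_eq(1) triple_mset_eq_iff by blast
    next
      fix t assume t: "t \<in> {(u, v), (u, w), (v, u), (v, w), (w, u), (w, v)}"
      then have "t \<in> T"
        unfolding T_def
        by (elim insertE emptyE) (simp_all add: thirds uv(2-4) w uv(4)[symmetric]
            w(2,3)[symmetric] del: inverse_mult_distrib)
      moreover have "case_prod point t = point u v"
        using t esym_eq_point[OF prod] by auto
      ultimately show "t \<in> {t \<in> T. case_prod point t = case_prod point s}"
        unfolding uv(1) by simp
    qed
    then show "card {t \<in> T. case_prod point t = case_prod point s} = 6"
      using uv w by simp
  qed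
  moreover have "card T + 3 * a = a ^ 2 + 2 * gcd a 3"
  proof -
    define C where "C = A \<inter> unity_roots 3"
    \<comment> \<open>Removing the cube roots of unity from two of the three families makes them disjoint.\<close>
    let ?X = "(\<lambda>u. (u, u)) ` A" and ?Y = "(\<lambda>u. (u, inverse (u * u))) ` (A - C)"
      and ?Z = "(\<lambda>u. (inverse (u * u), u)) ` (A - C)"
    have C: "u \<in> C \<longleftrightarrow> inverse (u * u) = u" if "u \<in> A" for u
      using cube_root_of_unity_iff[OF nz[OF that]] that by (simp add: C_def)
    have "card C = gcd a 3"
      using A(3) finite_unity_roots_dvd(2)[OF dvd_trans[OF gcd_dvd1 a] coprime_q(1)]
      unfolding C_def A_def by (subst unity_roots_Int) auto
    moreover have "card (A - C) + card C = a"
      using card_Int_Diff[OF A(1), of "unity_roots 3"] A(2) by (simp add: C_def Diff_Int)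
    moreover have pairs: "A \<times> A = T \<union> (?X \<union> (?Y \<union> ?Z))"
    proof (intro equalityI)
      show "T \<union> (?X \<union> (?Y \<union> ?Z)) \<subseteq> A \<times> A"
      proof (intro Un_least)
        show "T \<subseteq> A \<times> A" unfolding T_def by blast
      qed (use inv in blast)+
      show "A \<times> A \<subseteq> T \<union> (?X \<union> (?Y \<union> ?Z))"
      proof (intro subrelI)
        fix u v assume uv: "(u, v) \<in> A \<times> A"
        then have nz': "u \<noteq> 0" "v \<noteq> 0" using nz by auto
        have "v = inverse (u * u)" if "u = inverse (u * v)"
        proof (rule inverse_unique[symmetric])
          show "u * u * v = 1" using point_prod[OF nz'] that by (simp add: mult_ac)
        qed
        moreover have "u = inverse (v * v)" if "v = inverse (u * v)"
        proof (rule inverse_unique[symmetric])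
          show "v * v * u = 1" using point_prod[OF nz'] that by (simp add: mult_ac)
        qed
        ultimately consider "(u, v) \<in> T" | "u = v" | "v = inverse (u * u)" | "u = inverse (v * v)"
          using uv unfolding T_def by blast
        then show "(u, v) \<in> T \<union> (?X \<union> (?Y \<union> ?Z))"
        proof cases
          case 3
          then show ?thesis using uv C[of u] by (cases "u \<in> C") blast+
        next
          case 4
          then show ?thesis using uv C[of v] by (cases "v \<in> C") blast+
        qed (use uv in blast)+
      qed
    qed
    moreover have "card (A \<times> A) = card T + (card ?X + (card ?Y + card ?Z))"
    proof -
      have "?Y \<inter> ?Z = {}"
      proof (rule equals0I)
        fix p assume p: "p \<in> ?Y \<inter> ?Z"
        from p obtain u where u: "u \<in> A - C" "p = (u, inverse (u * u))" by blast
        from p obtain v where v: "v \<in> A - C" "p = (inverse (v * v), v)" by blast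
        have eq: "(inverse (v * v), v) = (u, inverse (u * u))"
          using u(2) v(2) by (rule trans[OF sym, rotated])
        have uv: "u \<in> A - C" "v \<in> A - C" "u = inverse (v * v)" "v = inverse (u * u)"
          using u(1) v(1) arg_cong[OF eq, of fst] arg_cong[OF eq, of snd]
          unfolding fst_conv snd_conv by blast+
        then have nz': "u \<noteq> 0" "v \<noteq> 0" using nz by blast+
        have "u * v * v = 1" "u * v * u = 1"
          using point_prod[OF nz'(1,1)] point_prod[OF nz'(2,2)] uv(3,4)[symmetric]
          by (simp_all only: mult_ac)
        then have "u = v" using nz' by (metis mult_left_cancel mult_eq_0_iff)
        then have "inverse (u * u) = u" using uv(4) by metis
        then show False using uv(1) C[of u] by blast
      qed
      moreover have "?X \<inter> (?Y \<union> ?Z) = {}"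
        using C by auto
      moreover have "(u, u) \<notin> T" "(u, inverse (u * u)) \<notin> T" "(inverse (u * u), u) \<notin> T"
        if "u \<in> A" for u
      proof -
        have prod: "u * inverse (u * u) * u = 1" "inverse (u * u) * u * u = 1"
          using point_prod[OF nz[OF that] nz[OF that]] by (simp_all only: mult_ac)
        from inverse_unique[OF prod(1)] inverse_unique[OF prod(2)]
        show "(u, u) \<notin> T" "(u, inverse (u * u)) \<notin> T" "(inverse (u * u), u) \<notin> T"
          unfolding T_def by (simp_all only: mem_Collect_eq prod.case simp_thms)
      qed
      then have "T \<inter> (?X \<union> (?Y \<union> ?Z)) = {}"
        by blast
      ultimately show ?thesis
        unfolding pairs using finT A(1) by (subst card_Un_disjoint, simp_all)+
    qed
    moreover have "card ?X = a" "card ?Y = card (A - C)" "card ?Z = card (A - C)"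
      unfolding A(2)[symmetric] by (intro card_image inj_onI, simp)+
    moreover have "card (A \<times> A) = a ^ 2"
      using A by (simp add: card_cartesian_product power2_eq_square)
    ultimately show ?thesis by linarith
  qed
  ultimately show ?thesis by simp
qed

lemma irrational_nonzero:
  assumes "u \<in> unity_roots n" "n > 0" "u \<notin> rational_units"
  shows "u \<noteq> 0" "u ^ q \<noteq> 0" "u ^ q \<noteq> u" "u ^ q \<notin> rational_units"
  using unity_roots_nonzero[OF assms(1,2)] assms(3) frobenius_rational_units rational_units_iff
  by auto

lemma quadratic_third:
  assumes "u \<in> unity_roots (q ^ 2 - 1)"
  shows "(u ^ q) ^ q = (u :: 'k)" "inverse (u * u ^ q) \<in> rational_units"
proof -
  have u: "u \<noteq> 0" using unity_roots_nonzero[OF assms square_minus_1_pos] .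
  then show q2: "(u ^ q) ^ q = u" using quadratic_root_of_unity assms by blast
  show "inverse (u * u ^ q) \<in> rational_units"
    using u q2 by (simp add: rational_units_iff power_inverse power_mult_distrib mult.commute)
qed

text \<open>
  For irrational \<open>u\<close> the triple \<open>u\<close>, \<open>u\<^sup>q\<close>, \<open>u\<^bsup>-1-q\<^esup>\<close> has exactly two irrational entries, \<open>u\<close> and its
  conjugate, and either of them produces the point.
\<close>

lemma card_quadratic_points:
  assumes b: "b dvd q ^ 2 - 1"
  shows "2 * card ((\<lambda>u. point u (u ^ q)) ` (unity_roots b - rational_units :: 'k set)) + gcd b (q - 1) = b"
proof -
  let ?B = "unity_roots b - rational_units :: 'k set"
  have B: "finite (unity_roots b :: 'k set)" "card (unity_roots b :: 'k set) = b" "b > 0"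
    using finite_unity_roots_dvd[OF b coprime_q(2)] by blast+
  have "card ?B = 2 * card ((\<lambda>u. point u (u ^ q)) ` ?B)"
  proof (rule card_eq_mult_card_image)
    fix u assume u: "u \<in> ?B"
    note irr = irrational_nonzero[of _ b, OF _ B(3)]
    note third = quadratic_third[OF unity_roots_dvd[OF _ b]]
    have "{t \<in> ?B. point t (t ^ q) = point u (u ^ q)} = {u, u ^ q}"
    proof (intro equalityI subsetI)
      fix t assume t: "t \<in> {t \<in> ?B. point t (t ^ q) = point u (u ^ q)}"
      then have "{#t, t ^ q, inverse (t * t ^ q)#} = {#u, u ^ q, inverse (u * u ^ q)#}"
        using irr u by (intro point_eq_iff[THEN iffD1]) auto
      then have "t \<in> {u, u ^ q, inverse (u * u ^ q)}"
        unfolding triple_mset_eq_iff by blast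
      then show "t \<in> {u, u ^ q}" using t u third(2)[of u] by blast
    next
      fix t assume "t \<in> {u, u ^ q}"
      moreover have "point (u ^ q) ((u ^ q) ^ q) = point u (u ^ q)"
        using third(1)[of u] u by (simp add: point_def esym_def mult_ac add_ac)
      moreover have "u ^ q \<in> ?B"
        using u irr unity_roots_power by blast
      ultimately show "t \<in> {t \<in> ?B. point t (t ^ q) = point u (u ^ q)}"
        using u by auto
    qed
    then show "card {t \<in> ?B. point t (t ^ q) = point u (u ^ q)} = 2"
      using irr(3)[of u] u by simp
  qed (use B in simp)
  moreover have "card ?B + gcd b (q - 1) = b"
    by (rule card_irrational_unity_roots[OF b coprime_q(2)])
  ultimately show ?thesis by simp
qed

text \<open>
  For irrational \<open>u\<close> the three entries are distinct conjugates, and each of them produces the point.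
\<close>

lemma card_cubic_points:
  assumes c: "c dvd q ^ 2 + q + 1"
  shows "3 * card ((\<lambda>u. point u (u ^ q)) ` (unity_roots c - rational_units :: 'k set)) + gcd c (q - 1) = c"
proof -
  let ?C = "unity_roots c - rational_units :: 'k set"
  have C: "finite (unity_roots c :: 'k set)" "card (unity_roots c :: 'k set) = c" "c > 0"
    using finite_unity_roots_dvd[OF c coprime_q(3)] by blast+
  have "card ?C = 3 * card ((\<lambda>u. point u (u ^ q)) ` ?C)"
  proof (rule card_eq_mult_card_image)
    fix u assume u: "u \<in> ?C"
    note irr = irrational_nonzero[of _ c, OF _ C(3)]
    note frob = cubic_frobenius[OF unity_roots_dvd[OF _ c]]
    have prod: "u * u ^ q * (u ^ q) ^ q = 1"
      using unity_roots_dvd[OF _ c] u cubic_root_of_unity by blast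
    have mem: "u ^ q \<in> ?C" "(u ^ q) ^ q \<in> ?C"
      using u irr(4) unity_roots_power by blast+
    have "{t \<in> ?C. point t (t ^ q) = point u (u ^ q)} = {u, u ^ q, (u ^ q) ^ q}"
    proof (intro equalityI subsetI)
      fix t assume t: "t \<in> {t \<in> ?C. point t (t ^ q) = point u (u ^ q)}"
      then have "{#t, t ^ q, inverse (t * t ^ q)#} = {#u, u ^ q, inverse (u * u ^ q)#}"
        using irr u by (intro point_eq_iff[THEN iffD1]) auto
      then show "t \<in> {u, u ^ q, (u ^ q) ^ q}"
        using frob(2)[of u] u unfolding triple_mset_eq_iff by blast
    next
      fix t assume "t \<in> {u, u ^ q, (u ^ q) ^ q}"
      then show "t \<in> {t \<in> ?C. point t (t ^ q) = point u (u ^ q)}"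
        using u mem frob(1)[of u] esym_eq_point[OF prod] by auto
    qed
    moreover have "u \<noteq> (u ^ q) ^ q"
      using frob(1)[of u] u irr(3)[of u] by auto
    ultimately show "card {t \<in> ?C. point t (t ^ q) = point u (u ^ q)} = 3"
      using irr(3)[of u] u by auto
  qed (use C in simp)
  moreover have "card ?C + gcd c (q - 1) = c"
    by (rule card_irrational_unity_roots[OF c coprime_q(3)])
  ultimately show ?thesis by simp
qed

text \<open>
  A rational \<open>u\<close> in either family gives \<open>point u (u ^ q) = point u u\<close>, whose repeated entry recovers \<open>u\<close>.
  The split, quadratic and cubic families can overlap only in such points.
\<close>

lemma card_double_points:
  assumes "b > 0" "c > 0"
  shows "card ((\<lambda>u. point u u) ` ((unity_roots b \<union> unity_roots c) \<inter> rational_units :: 'k set))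
    + gcd (gcd b (q - 1)) (gcd c (q - 1)) = gcd b (q - 1) + gcd c (q - 1)"
proof -
  let ?R = "(unity_roots b \<union> unity_roots c) \<inter> rational_units :: 'k set"
  have "inj_on (\<lambda>u. point u u) ?R"
    using rational_units_iff by (intro inj_onI) (auto simp: point_eq_iff triple_mset_eq_iff)
  moreover have "?R = unity_roots (gcd b (q - 1)) \<union> unity_roots (gcd c (q - 1))"
    unfolding rational_units_def Int_Un_distrib2 using assms q_gt_1 by (simp add: unity_roots_Int)
  moreover have "unity_roots (gcd b (q - 1)) \<inter> unity_roots (gcd c (q - 1)) =
      (unity_roots (gcd (gcd b (q - 1)) (gcd c (q - 1))) :: 'k set)"
    using assms by (intro unity_roots_Int) auto
  moreover have "card (unity_roots d :: 'k set) = d" "finite (unity_roots d :: 'k set)" if "d dvd q - 1" for d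
    using finite_unity_roots_dvd[OF that coprime_q(1)] by blast+
  ultimately show ?thesis
    using card_Un_Int[of "unity_roots (gcd b (q - 1)) :: 'k set" "unity_roots (gcd c (q - 1))"]
    by (simp add: card_image dvd_trans[OF gcd_dvd1 gcd_dvd2])
qed

text \<open>
  The union splits into points with distinct rational entries, points with a repeated entry, and
  irrational points of quadratic and of cubic type. These four parts are disjoint because the
  multiset of entries determines the point, and the parts differ in how many entries are rational
  or repeated. The summands with \<open>gcd\<close> correct for the points with a repeated entry.
\<close>

lemma card_value_set:
  assumes a: "a dvd q - 1" and b: "b dvd q ^ 2 - 1" and c: "c dvd q ^ 2 + q + 1" and ab: "a dvd b"
  shows "6 * card (case_prod point ` (unity_roots a \<times> unity_roots a) \<union>
      (\<lambda>u. point u (u ^ q)) ` (unity_roots b \<union> unity_roots c) :: ('k \<times> 'k) set)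
    + 3 * a + 6 * gcd (gcd b (q - 1)) (gcd c (q - 1)) =
    a ^ 2 + 3 * b + 2 * c + 2 * gcd a 3 + 3 * gcd b (q - 1) + 4 * gcd c (q - 1)"
proof -
  define A where "A = (unity_roots a :: 'k set)"
  define T where "T = {(u, v). u \<in> A \<and> v \<in> A \<and> u \<noteq> v \<and> u \<noteq> inverse (u * v) \<and> v \<noteq> inverse (u * v)}"
  define B where "B = unity_roots b - (rational_units :: 'k set)"
  define C where "C = unity_roots c - (rational_units :: 'k set)"
  define R where "R = (unity_roots b \<union> unity_roots c) \<inter> (rational_units :: 'k set)"
  let ?conj = "\<lambda>u :: 'k. point u (u ^ q)"
  have fin: "finite A" "finite (unity_roots b :: 'k set)" "finite (unity_roots c :: 'k set)"
    and pos: "b > 0" "c > 0"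
    unfolding A_def using finite_unity_roots_dvd a b c coprime_q by blast+
  \<comment> \<open>The split family produces double points \<open>point u u\<close> only with \<open>u \<in> A\<close>; as \<open>a dvd b\<close>, all of them are among those indexed by \<open>R\<close>.\<close>
  have A_rational: "A \<subseteq> rational_units" and A_R: "A \<subseteq> R"
    unfolding A_def R_def rational_units_def using unity_roots_dvd a ab by blast+
  have nz: "u \<noteq> 0" if "u \<in> rational_units" for u using that rational_units_iff by blast
  have rational_third: "inverse (u * v) \<in> rational_units" if "u \<in> rational_units" "v \<in> rational_units" for u v
    using that unity_roots_mult unity_roots_inverse unfolding rational_units_def by blast
  have irr: "u \<noteq> 0" "u ^ q \<noteq> 0" "u ^ q \<notin> rational_units" "u \<notin> rational_units" if "u \<in> B \<union> C" for u
    using that irrational_nonzero pos unfolding B_def C_def by blast+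
  have decomp: "case_prod point ` (A \<times> A) \<union> ?conj ` (unity_roots b \<union> unity_roots c) =
      (case_prod point ` T \<union> (\<lambda>u. point u u) ` R) \<union> (?conj ` B \<union> ?conj ` C)" (is "?L = ?S")
  proof -
    have R_conj: "(\<lambda>u. point u u) ` R = ?conj ` R"
      using rational_units_iff unfolding R_def by (intro image_cong) auto
    have cover: "point u v \<in> case_prod point ` T \<union> (\<lambda>u. point u u) ` R" if uv: "u \<in> A" "v \<in> A" for u v
    proof (cases "(u, v) \<in> T")
      case False
      have prod: "u * v * inverse (u * v) = 1"
        using uv A_rational nz by (intro point_prod) auto
      from False uv have "u = v \<or> u = inverse (u * v) \<or> v = inverse (u * v)"
        unfolding T_def by blast
      then have "point u v = point u u \<or> point u v = point v v"
        using esym_eq_point[OF prod] by metis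
      then show ?thesis using uv A_R by blast
    qed force
    have "case_prod point ` (A \<times> A) \<subseteq> case_prod point ` T \<union> (\<lambda>u. point u u) ` R"
    proof (intro image_subsetI)
      fix t assume "t \<in> A \<times> A"
      then obtain u v where "t = (u, v)" "u \<in> A" "v \<in> A" by blast
      with cover[of u v] show "case_prod point t \<in> case_prod point ` T \<union> (\<lambda>u. point u u) ` R"
        by simp
    qed
    moreover have "case_prod point ` T \<subseteq> case_prod point ` (A \<times> A)"
      unfolding T_def by auto
    moreover have "unity_roots b \<union> unity_roots c = R \<union> (B \<union> C)"
      unfolding R_def B_def C_def by blast
    ultimately show ?thesis unfolding R_conj by (simp only: image_Un) blast
  qed
  have disj1: "(case_prod point ` T \<union> (\<lambda>u. point u u) ` R) \<inter> (?conj ` B \<union> ?conj ` C) = {}"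
  proof -
    have neq: "point x y \<noteq> point u (u ^ q)"
      if "x \<in> rational_units" "y \<in> rational_units" "u \<in> B \<union> C" for x y u
    proof
      assume "point x y = point u (u ^ q)"
      then have "{#u, u ^ q, inverse (u * u ^ q)#} = {#x, y, inverse (x * y)#}"
        using that nz irr by (intro point_eq_iff[THEN iffD1]) auto
      then have "u \<in> {x, y, inverse (x * y)}"
        unfolding triple_mset_eq_iff by blast
      then show False using that rational_third irr(4) by blast
    qed
    have rep: "\<exists>x y. x \<in> rational_units \<and> y \<in> rational_units \<and> P = point x y"
      if "P \<in> case_prod point ` T \<union> (\<lambda>u. point u u) ` R" for P
    proof -
      have "T \<subseteq> rational_units \<times> rational_units" "R \<subseteq> rational_units"
        using A_rational unfolding T_def R_def by blast+
      with that show ?thesis by auto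
    qed
    show ?thesis
    proof (rule equals0I)
      fix P assume P: "P \<in> (case_prod point ` T \<union> (\<lambda>u. point u u) ` R) \<inter> (?conj ` B \<union> ?conj ` C)"
      then obtain x y where xy: "x \<in> rational_units" "y \<in> rational_units" "P = point x y"
        using rep by blast
      from P obtain u where u: "u \<in> B \<union> C" "P = point u (u ^ q)"
        by blast
      show False using neq[OF xy(1,2) u(1)] xy(3) u(2) by simp
    qed
  qed
  have disj2: "case_prod point ` T \<inter> (\<lambda>u. point u u) ` R = {}"
  proof -
    have "point u v \<noteq> point x x" if "(u, v) \<in> T" "x \<in> R" for u v x
    proof
      assume "point u v = point x x"
      moreover have "u \<noteq> 0" "v \<noteq> 0" "x \<noteq> 0"
        using that A_rational nz unfolding T_def R_def by auto
      ultimately have "{#u, v, inverse (u * v)#} = {#x, x, inverse (x * x)#}"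
        by (intro point_eq_iff[THEN iffD1])
      then show False
        using that(1) unfolding T_def triple_mset_eq_iff by (auto simp del: inverse_mult_distrib)
    qed
    then show ?thesis by force
  qed
  have disj3: "?conj ` B \<inter> ?conj ` C = {}"
  proof -
    have "point u (u ^ q) \<noteq> point v (v ^ q)" if "u \<in> B" "v \<in> C" for u v
    proof
      assume "point u (u ^ q) = point v (v ^ q)"
      then have "{#u, u ^ q, inverse (u * u ^ q)#} = {#v, v ^ q, inverse (v * v ^ q)#}"
        using that irr by (intro point_eq_iff[THEN iffD1]) auto
      then have "inverse (u * u ^ q) \<in> {v, v ^ q, inverse (v * v ^ q)}"
        unfolding triple_mset_eq_iff by blast
      moreover have "inverse (v * v ^ q) = (v ^ q) ^ q"
        using that cubic_frobenius(2) unity_roots_dvd[OF _ c] unfolding C_def by blast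
      \<comment> \<open>A quadratic triple has a rational entry, an irrational cubic one has none.\<close>
      moreover have "inverse (u * u ^ q) \<in> rational_units"
        using that quadratic_third(2) unity_roots_dvd[OF _ b] unfolding B_def by blast
      moreover have "v \<notin> rational_units" "v ^ q \<notin> rational_units" "(v ^ q) ^ q \<notin> rational_units"
        using that(2) irr(4)[of v] unfolding frobenius_rational_units by blast+
      ultimately show False by (metis empty_iff insert_iff)
    qed
    then show ?thesis by blast
  qed
  have "finite T" by (rule finite_subset[of _ "A \<times> A"]) (auto simp: T_def fin)
  then have "card ?S = (card (case_prod point ` T) + card ((\<lambda>u. point u u) ` R))
      + (card (?conj ` B) + card (?conj ` C))"
    using disj1 disj2 disj3 fin unfolding B_def C_def R_def
    by (subst card_Un_disjoint, simp_all)+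
  then show ?thesis
    using card_split_points[OF a] card_quadratic_points[OF b] card_cubic_points[OF c]
      card_double_points[OF pos] decomp
    unfolding A_def[symmetric] T_def[symmetric] B_def[symmetric] C_def[symmetric] R_def[symmetric]
    by simp
qed

end

section \<open>Arithmetic of the orders\<close>

lemma gcd_mult_gcd:
  fixes k m n :: nat
  shows "gcd k m * gcd k n = gcd (k * gcd k (gcd m n)) (m * n)"
proof -
  have "gcd k m * gcd k n = gcd (gcd (k * k) (k * m)) (gcd (k * n) (m * n))"
    by (simp add: gcd_mult_distrib_nat mult.commute)
  also have "\<dots> = gcd (gcd (k * k) (gcd (k * m) (k * n))) (m * n)"
    by (simp only: gcd.assoc)
  also have "\<dots> = gcd (k * gcd k (gcd m n)) (m * n)"
    by (simp add: gcd_mult_distrib_nat)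
  finally show ?thesis .
qed

text \<open>
  With \<open>b\<close> and \<open>a\<close> the orders of the groups of \<open>K\<close>-th powers in the fields of \<open>q\<^sup>2\<close> and \<open>q\<close> elements,
  \<open>gcd b (q - 1)\<close> is the number of nonzero elements of the smaller field that are \<open>K\<close>-th powers in the larger
  one. The discrepancy with \<open>a\<close> is the quotient of \<open>gcd(K, q-1) gcd(K, q+1)\<close> by \<open>gcd(K, q\<^sup>2-1)\<close>;
  only the prime \<open>2\<close> can contribute to it, as \<open>gcd(q-1, q+1)\<close> divides \<open>2\<close>.
\<close>

lemma gcd_quotient_rational:
  fixes K q :: nat
  assumes q: "q > 1" and K: "K > 0"
  defines "a \<equiv> (q - 1) div gcd K (q - 1)" and "b \<equiv> (q ^ 2 - 1) div gcd K (q ^ 2 - 1)"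
  shows "gcd b (q - 1) = (if even K \<and> even b then 2 * a else a)"
proof -
  define D where "D = gcd K (q ^ 2 - 1)"
  define g where "g = gcd K (gcd (q - 1) (q + 1))"
  obtain r where r: "q = r + 1" using q by (metis add.commute less_imp_add_positive)
  have factor: "q ^ 2 - 1 = (q - 1) * (q + 1)"
    by (simp add: r power2_eq_square algebra_simps)
  have bD: "b * D = q ^ 2 - 1"
    unfolding b_def D_def by simp
  have ad: "a * gcd K (q - 1) = q - 1" unfolding a_def by simp
  have D: "D > 0" using K by (simp add: D_def)
  have a: "a > 0" using ad q by (metis zero_less_diff mult_0 not_gr0 less_nat_zero_code)
  have "gcd b (q - 1) * D = gcd ((q - 1) * (q + 1)) ((q - 1) * D)"
    unfolding factor[symmetric] bD[symmetric] by (metis gcd_mult_distrib_nat mult.commute)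
  also have "\<dots> = (q - 1) * gcd (q + 1) D"
    by (simp only: gcd_mult_distrib_nat)
  also have "gcd (q + 1) D = gcd K (q + 1)"
    unfolding D_def factor by (metis gcd.commute gcd.left_commute gcd_nat.absorb1 dvd_triv_right)
  finally have "gcd b (q - 1) * D = a * (gcd K (q - 1) * gcd K (q + 1))"
    using ad by (metis mult.assoc)
  then have main: "gcd b (q - 1) * D = a * gcd (K * g) (b * D)"
    unfolding gcd_mult_gcd g_def bD factor .
  have "g dvd q + 1" "g dvd q - 1"
    unfolding g_def by (metis gcd_dvd1 gcd_dvd2 dvd_trans)+
  then have "g dvd (q + 1) - (q - 1)" by (rule dvd_diff_nat)
  then have "g dvd 2" using r by simp
  then consider "g = 1" | "g = 2" by (metis two_is_prime_nat prime_nat_iff)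
  then show ?thesis
  proof cases
    case 1
    have "gcd K (b * D) = D" unfolding bD by (simp add: D_def)
    then have "gcd b (q - 1) = a" using main 1 D by simp
    moreover have "\<not> (even K \<and> even b)"
    proof
      assume *: "even K \<and> even b"
      then have "even ((q - 1) * (q + 1))" unfolding factor[symmetric] bD[symmetric] by simp
      then have "even (q - 1)" "even (q + 1)" using r by auto
      then have "2 dvd g" using * unfolding g_def by simp
      then show False using 1 by simp
    qed
    ultimately show ?thesis by (simp only: if_False)
  next
    case 2
    then have "even K" unfolding g_def by (metis gcd_dvd1)
    obtain K' where K': "K = K' * D" unfolding D_def by (metis gcd_dvd1 dvd_div_mult_self)
    have "gcd (K' * D) (b * D) = 1 * D"
      unfolding bD K'[symmetric] by (simp add: D_def)
    then have "coprime K' b"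
      using D gcd_mult_distrib_nat[of D K' b] by (simp add: coprime_iff_gcd_eq_1 mult.commute)
    then have "gcd (K' * 2) b = gcd 2 b"
      by (simp add: gcd_mult_left_left_cancel coprime_commute)
    then have "gcd (K * g) (b * D) = gcd 2 b * D"
      using gcd_mult_distrib_nat[of D "K' * 2" b] by (simp add: K' 2 mult_ac)
    then have "gcd b (q - 1) = a * gcd 2 b"
      using main D by simp
    moreover have "gcd 2 b = (if even b then 2 else 1)"
      by (auto simp: gcd_nat.absorb1 coprime_iff_gcd_eq_1[symmetric])
    ultimately show ?thesis using \<open>even K\<close> by simp
  qed
qed

text \<open>
  The greatest common divisors in the equation count cube roots of unity: those among the \<open>a\<close>-th roots of
  unity, the rational ones among the \<open>c\<close>-th roots of unity, and those of the latter that are \<open>b\<close>-th roots of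
  unity as well. Because \<open>q\<^sup>2 + q + 1 = 3 + (q - 1)(q + 2)\<close>, all rational \<open>c\<close>-th roots of unity are of this kind. If \<open>3\<close> divides \<open>q - 1\<close>, then \<open>9\<close> does not divide
  \<open>q\<^sup>2 + q + 1\<close>, so \<open>3 dvd c\<close> holds exactly when \<open>3 dvd K\<close> fails. The counts therefore balance unless the
  nontrivial cube roots of unity occur among the \<open>a\<close>-th roots of unity but not among the \<open>c\<close>-th ones.
\<close>

lemma cube_roots_balance:
  fixes K q :: nat
  assumes q: "q > 1" and K: "K > 0"
  defines "a \<equiv> (q - 1) div gcd K (q - 1)" and "b \<equiv> (q ^ 2 - 1) div gcd K (q ^ 2 - 1)"
    and "c \<equiv> (q ^ 2 + q + 1) div gcd K (q ^ 2 + q + 1)"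
  shows "2 * gcd a 3 + 4 * gcd c (q - 1) =
    6 * gcd (gcd b (q - 1)) (gcd c (q - 1)) + (if 3 dvd K \<and> 3 dvd a then 4 else 0)"
proof -
  obtain r where r: "q = r + 1" using q by (metis add.commute less_imp_add_positive)
  have prods: "a * gcd K (q - 1) = q - 1" "b * gcd K (q ^ 2 - 1) = q ^ 2 - 1"
    "c * gcd K (q ^ 2 + q + 1) = q ^ 2 + q + 1"
    unfolding a_def b_def c_def by simp_all
  have gcd_prime: "gcd n 3 = (if 3 dvd n then 3 else 1)" for n :: nat
  proof -
    have "gcd n 3 \<in> {1, 3}"
      using gcd_dvd2[of n 3] prime_nat_iff[of 3] by auto
    then show ?thesis by (metis gcd_nat.absorb2 gcd_dvd1 insertE singletonD)
  qed
  have three_dvd_mult: "3 dvd m * n \<longleftrightarrow> 3 dvd m \<or> 3 dvd n" for m n :: nat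
    by (rule prime_dvd_mult_iff) simp
  have norm: "q ^ 2 + q + 1 = 3 + (q - 1) * (q + 2)"
    by (simp add: r power2_eq_square algebra_simps)
  have "gcd c (q - 1) dvd q ^ 2 + q + 1" 
    using prods(3) by (metis dvd_trans gcd_dvd1 dvd_triv_left)
  then have "gcd c (q - 1) dvd 3"
    unfolding norm by (metis dvd_add_left_iff gcd_dvd2 dvd_mult2)
  then have \<gamma>: "gcd c (q - 1) = (if 3 dvd c \<and> 3 dvd (q - 1) then 3 else 1)"
    using gcd_prime[of "gcd c (q - 1)"] by (simp add: gcd_nat.absorb1)
  show ?thesis
  proof (cases "3 dvd q - 1")
    case False
    then have "\<not> 3 dvd a" using prods(1) by (metis dvd_mult2)
    with False show ?thesis by (simp add: \<gamma> gcd_prime del: One_nat_def)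
  next
    case True
    then obtain t where t: "q - 1 = 3 * t" by blast
    then have t: "q = 3 * t + 1" using q by simp
    have "q ^ 2 + q + 1 = 3 * (3 * (t ^ 2 + t) + 1)"
      by (simp add: t power2_eq_square algebra_simps)
    then have nine: "\<not> 3 * 3 dvd q ^ 2 + q + 1" "3 dvd q ^ 2 + q + 1"
      by (simp_all only: dvd_mult_cancel_left) presburger+
    have three_c: "3 dvd c \<longleftrightarrow> \<not> 3 dvd K"
    proof
      assume "3 dvd c"
      then show "\<not> 3 dvd K" using nine prods(3) by (metis gcd_greatest mult_dvd_mono)
    next
      assume "\<not> 3 dvd K"
      then have "\<not> 3 dvd gcd K (q ^ 2 + q + 1)" by simp
      moreover have "3 dvd c * gcd K (q ^ 2 + q + 1)" using prods(3) nine(2) by simp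
      ultimately show "3 dvd c" using three_dvd_mult by blast
    qed
    show ?thesis
    proof (cases "3 dvd K")
      case True
      then show ?thesis by (simp add: \<gamma> three_c gcd_prime del: One_nat_def)
    next
      case K3: False
      have "3 dvd q ^ 2 - 1"
      proof -
        have "q ^ 2 - 1 = (q - 1) * (q + 1)" by (simp add: r power2_eq_square algebra_simps)
        then show ?thesis using True by simp
      qed
      then have "3 dvd b * gcd K (q ^ 2 - 1)" "3 dvd a * gcd K (q - 1)"
        unfolding prods using True by simp_all
      then have "3 dvd a" "3 dvd b"
        using K3 unfolding three_dvd_mult by simp_all
      then show ?thesis using True K3 by (simp add: \<gamma> three_c gcd_prime del: One_nat_def)
    qed
  qed
qed

section \<open>The size of the value set\<close>

text \<open>
  The embedding into the algebraic closure commutes with the Chebyshev map and identifies the plane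
  over the finite field with the points fixed by Frobenius, so the value set can be counted there.
\<close>

lemma card_range_cheb_map:
  fixes k :: int
  assumes k: "k \<noteq> 0"
  defines "q \<equiv> card (UNIV :: 'a::{field, finite} set)" and "K \<equiv> nat \<bar>k\<bar>"
  defines "a \<equiv> (q - 1) div gcd K (q - 1)" and "b \<equiv> (q ^ 2 - 1) div gcd K (q ^ 2 - 1)"
    and "c \<equiv> (q ^ 2 + q + 1) div gcd K (q ^ 2 + q + 1)"
  shows "6 * card (range (cheb_map k :: 'a \<times> 'a \<Rightarrow> 'a \<times> 'a)) =
    a ^ 2 + 3 * b + 2 * c + (if even K \<and> even b then 3 * a else 0) +
    (if 3 dvd K \<and> 3 dvd a then 4 else 0)"
proof -
  interpret frobenius "TYPE('a alg_closure)" q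
    unfolding q_def by (rule frobenius_alg_closure)
  let ?\<iota> = "map_prod to_ac to_ac :: 'a \<times> 'a \<Rightarrow> 'a alg_closure \<times> 'a alg_closure"
  let ?F = "{P :: 'a alg_closure \<times> 'a alg_closure. fst P ^ q = fst P \<and> snd P ^ q = snd P}"
  let ?V = "case_prod point ` (unity_roots a \<times> unity_roots a) \<union>
    (\<lambda>u. point u (u ^ q)) ` (unity_roots b \<union> unity_roots c) :: ('a alg_closure \<times> 'a alg_closure) set"
  have K: "K > 0" using k by (simp add: K_def)
  have prods: "a * gcd K (q - 1) = q - 1" "b * gcd K (q ^ 2 - 1) = q ^ 2 - 1"
    "c * gcd K (q ^ 2 + q + 1) = q ^ 2 + q + 1"
    unfolding a_def b_def c_def by simp_all
  have "range ?\<iota> = range to_ac \<times> range to_ac" by auto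
  also have "\<dots> = ?F" unfolding range_to_ac q_def by auto
  finally have range_\<iota>: "range ?\<iota> = ?F" .
  have "?\<iota> (cheb_map k P) = cheb_map k (?\<iota> P)" for P
    by (cases P) (simp add: cheb_map_def to_ac_eval2_gen_cheb)
  then have "?\<iota> ` range (cheb_map k) = cheb_map k ` range ?\<iota>"
    unfolding image_image by simp
  also have "\<dots> = ?V"
    unfolding range_\<iota> a_def b_def c_def K_def by (rule image_cheb_map_rational_points[OF k])
  finally have "?\<iota> ` range (cheb_map k) = ?V" .
  moreover have "inj ?\<iota>"
    by (auto simp: inj_on_def)
  then have "inj_on ?\<iota> (range (cheb_map k))"
    by (rule inj_on_subset) simp
  ultimately have card_V: "card ?V = card (range (cheb_map k :: 'a \<times> 'a \<Rightarrow> 'a \<times> 'a))"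
    using card_image by metis
  have beta: "gcd b (q - 1) = (if even K \<and> even b then 2 * a else a)"
    unfolding a_def b_def by (rule gcd_quotient_rational[OF q_gt_1 K])
  have dvd: "a dvd q - 1" "b dvd q ^ 2 - 1" "c dvd q ^ 2 + q + 1"
    using prods by (metis dvd_triv_left)+
  have "a dvd gcd b (q - 1)"
    unfolding beta by simp
  then have "a dvd b" by simp
  from card_value_set[OF dvd this]
  have "6 * card (range (cheb_map k :: 'a \<times> 'a \<Rightarrow> 'a \<times> 'a)) + 3 * a
      + 6 * gcd (gcd b (q - 1)) (gcd c (q - 1)) =
      a ^ 2 + 3 * b + 2 * c + 2 * gcd a 3 + 3 * gcd b (q - 1) + 4 * gcd c (q - 1)"
    unfolding card_V .
  moreover have "2 * gcd a 3 + 4 * gcd c (q - 1) =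
      6 * gcd (gcd b (q - 1)) (gcd c (q - 1)) + (if 3 dvd K \<and> 3 dvd a then 4 else 0)"
    unfolding a_def b_def c_def by (rule cube_roots_balance[OF q_gt_1 K])
  moreover have "3 * gcd b (q - 1) = 3 * a + (if even K \<and> even b then 3 * a else 0)"
    unfolding beta by simp
  ultimately show ?thesis by linarith
qed

theorem theorem4p2:
  fixes k :: int and q :: nat
  assumes "k \<noteq> 0"
    and "q = card (UNIV :: 'a::{field, finite} set)"
  shows "real (card (range (cheb_map k :: 'a \<times> 'a \<Rightarrow> 'a \<times> 'a))) =
           of_int (cheb_a k q) ^ 2 / 6 + of_int (cheb_b k q) / 2 + of_int (cheb_c k q) / 3
           + cheb_eta k q
         \<and> (gcd k 6 = 1 \<longrightarrow> cheb_eta k q = 0)"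
proof
  define K where "K = nat \<bar>k\<bar>"
  define a where "a = (q - 1) div gcd K (q - 1)"
  define b where "b = (q ^ 2 - 1) div gcd K (q ^ 2 - 1)"
  define c where "c = (q ^ 2 + q + 1) div gcd K (q ^ 2 + q + 1)"
  have q: "q > 0" unfolding assms(2) by (simp add: card_gt_0_iff)
  have gcd_int: "gcd k (int n) = int (gcd K n)" for n
    unfolding K_def by (simp flip: gcd_int_int_eq)
  have int_diff: "int q - 1 = int (q - 1)" "int q ^ 2 - 1 = int (q ^ 2 - 1)"
    "int q ^ 2 + int q + 1 = int (q ^ 2 + q + 1)"
    using q by (simp_all add: of_nat_diff)
  have abc: "cheb_a k q = int a" "cheb_b k q = int b" "cheb_c k q = int c"
    unfolding cheb_a_def cheb_b_def cheb_c_def int_diff gcd_int a_def b_def c_def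
    by (simp_all only: zdiv_int)
  have K_dvd: "2 dvd k \<longleftrightarrow> even K" "3 dvd k \<longleftrightarrow> 3 dvd K"
    unfolding K_def by (simp_all flip: int_dvd_int_iff)
  have "6 * card (range (cheb_map k :: 'a \<times> 'a \<Rightarrow> 'a \<times> 'a)) =
    a ^ 2 + 3 * b + 2 * c + (if even K \<and> even b then 3 * a else 0) +
    (if 3 dvd K \<and> 3 dvd a then 4 else 0)"
    unfolding a_def b_def c_def K_def assms(2) by (rule card_range_cheb_map[OF assms(1)])
  from arg_cong[OF this, of real] have "6 * real (card (range (cheb_map k :: 'a \<times> 'a \<Rightarrow> 'a \<times> 'a))) =
    real a ^ 2 + 3 * real b + 2 * real c + (if even K \<and> even b then 3 * real a else 0) +
    (if 3 dvd K \<and> 3 dvd a then 4 else 0)"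
    by (simp only: of_nat_add of_nat_mult of_nat_power of_nat_numeral of_nat_0 if_distrib[of real])
  moreover have "6 * cheb_eta k q = (if even K \<and> even b then 3 * real a else 0) +
    (if 3 dvd K \<and> 3 dvd a then 4 else 0)"
    unfolding cheb_eta_def Let_def abc K_dvd using int_dvd_int_iff[of 2 b] int_dvd_int_iff[of 3 a] by auto
  ultimately show "real (card (range (cheb_map k :: 'a \<times> 'a \<Rightarrow> 'a \<times> 'a))) =
      of_int (cheb_a k q) ^ 2 / 6 + of_int (cheb_b k q) / 2 + of_int (cheb_c k q) / 3
      + cheb_eta k q"
    unfolding abc by simp
  show "gcd k 6 = 1 \<longrightarrow> cheb_eta k q = 0"
  proof
    assume "gcd k 6 = 1"
    then have "\<not> 2 dvd k" "\<not> 3 dvd k"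
      using gcd_greatest[of 2 k 6] gcd_greatest[of 3 k 6] by auto
    then show "cheb_eta k q = 0" by (simp add: cheb_eta_def)
  qed
qed

end
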